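(* The axiom $\mathrm{NCF}$ (Near Coherence of Filters) implies that every non-principal ultrafilter on $\omega$ contains a tower.
   Context: $A\subseteq^*B$ means that $A\setminus B$ is finite. Filters on $\omega$ are proper and contain all cofinite sets; in particular ultrafilters are non-principal. A tower in a filter $\mathcal{F}$ is a sequence $(T_\alpha)_{\alpha<\kappa}$ of elements of $\mathcal{F}$, $\kappa$ a cardinal, with $T_\beta\subseteq^*T_\alpha$ for $\alpha\le\beta<\kappa$, such that no infinite $X\subseteq\omega$ satisfies $X\subseteq^*T_\alpha$ for all $\alpha<\kappa$. For ultrafilters $\mathcal{V},\mathcal{U}$ on $\omega$, $\mathcal{V}\le_{\mathrm{KB}}\mathcal{U}$ (Katětov–Blass order) means that there is a finite-to-one function $f:\omega\to\omega$ such that $f^{-1}[X]\in\mathcal{U}$ for every $X\in\mathcal{V}$. $\mathrm{NCF}$ is the statement: for every two ultrafilters $\mathcal{U}_0,\mathcal{U}_1$ on $\omega$ there is an ultrafilter $\mathcal{V}$ on $\omega$ such that $\mathcal{V}\le_{\mathrm{KB}}\mathcal{U}_0$ and $\mathcal{V}\le_{\mathrm{KB}}\mathcal{U}_1$. *)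

theory Defs
  imports Main
begin

definition almost_subset :: "'a set \<Rightarrow> 'a set \<Rightarrow> bool"  (infix "\<subseteq>\<^sup>*" 50) where
  "A \<subseteq>\<^sup>* B \<longleftrightarrow> finite (A - B)"

text \<open>
  A set \<open>X\<close> belongs to a library filter \<open>F\<close> iff \<open>\<forall>\<^sub>F n in F. n \<in> X\<close>.
  The order on the library's filters is reverse inclusion, so \<open>F \<le> cofinite\<close> says that \<open>F\<close> contains
  all cofinite sets; \<open>bot\<close> is the improper filter.
\<close>

definition omega_filter :: "nat filter \<Rightarrow> bool" where
  "omega_filter F \<longleftrightarrow> F \<noteq> bot \<and> F \<le> cofinite"

definition omega_ultrafilter :: "nat filter \<Rightarrow> bool" where
  "omega_ultrafilter U \<longleftrightarrow>
     omega_filter U \<and> (\<forall>X. (\<forall>\<^sub>F n in U. n \<in> X) \<or> (\<forall>\<^sub>F n in U. n \<in> - X))"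

text \<open>
  A cardinal \<open>\<kappa>\<close> is a well-order satisfying \<open>Card_order\<close>; the ordinals below it are the elements of
  \<open>Field \<kappa>\<close>, and \<open>(\<alpha>, \<beta>) \<in> \<kappa>\<close> means \<open>\<alpha> \<le> \<beta> < \<kappa>\<close>.
\<close>

definition tower_in :: "nat filter \<Rightarrow> 'k rel \<Rightarrow> ('k \<Rightarrow> nat set) \<Rightarrow> bool" where
  "tower_in F \<kappa> T \<longleftrightarrow>
     Card_order \<kappa> \<and>
     (\<forall>\<alpha>\<in>Field \<kappa>. \<forall>\<^sub>F n in F. n \<in> T \<alpha>) \<and>
     (\<forall>\<alpha> \<beta>. (\<alpha>, \<beta>) \<in> \<kappa> \<longrightarrow> T \<beta> \<subseteq>\<^sup>* T \<alpha>) \<and>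
     \<not> (\<exists>X. infinite X \<and> (\<forall>\<alpha>\<in>Field \<kappa>. X \<subseteq>\<^sup>* T \<alpha>))"

text \<open>
  HOL cannot quantify existentially over the type carrying \<open>\<kappa>\<close>, so one is fixed; \<^typ>\<open>nat set\<close>
  accommodates every cardinal up to the continuum. No generality is lost: restricting a tower in a
  filter to a cofinal subsequence gives a tower of length \<open>cf(\<kappa>)\<close>, and \<open>cf(\<kappa>)\<close> is at most the
  continuum, since otherwise some value would occur cofinally often and would be an infinite
  pseudo-intersection of the tower.
\<close>

definition contains_tower :: "nat filter \<Rightarrow> bool" where
  "contains_tower F \<longleftrightarrow> (\<exists>(\<kappa> :: nat set rel) T. tower_in F \<kappa> T)"

definition finite_to_one :: "('a \<Rightarrow> 'b) \<Rightarrow> bool" where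
  "finite_to_one f \<longleftrightarrow> (\<forall>y. finite (f -` {y}))"

definition KB_le :: "nat filter \<Rightarrow> nat filter \<Rightarrow> bool"  (infix "\<le>\<^sub>K\<^sub>B" 50) where
  "V \<le>\<^sub>K\<^sub>B U \<longleftrightarrow>
     (\<exists>f :: nat \<Rightarrow> nat. finite_to_one f \<and>
        (\<forall>X. (\<forall>\<^sub>F n in V. n \<in> X) \<longrightarrow> (\<forall>\<^sub>F n in U. n \<in> f -` X)))"

definition NCF :: bool where
  "NCF \<longleftrightarrow>
     (\<forall>U\<^sub>0 U\<^sub>1. omega_ultrafilter U\<^sub>0 \<longrightarrow> omega_ultrafilter U\<^sub>1 \<longrightarrow>
        (\<exists>V. omega_ultrafilter V \<and> V \<le>\<^sub>K\<^sub>B U\<^sub>0 \<and> V \<le>\<^sub>K\<^sub>B U\<^sub>1))"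

end

theory Submission
  imports Defs "HOL-Library.Nat_Bijection" "HOL-Library.Infinite_Set"
begin

text \<open>
  Let \<open>\<kappa>\<close> be the least size of a \<open>\<le>\<^sup>*\<close>-unbounded family of functions, and choose an unbounded
  family \<open>(g \<alpha>)\<close> of length \<open>\<kappa>\<close> such that each \<open>g \<alpha>\<close> is monotone and eventually dominates the
  five-fold iterates of all earlier members.

  If the family is dominating, NCF fails. Iterating \<open>g \<alpha>\<close> from \<open>0\<close> cuts \<open>\<omega>\<close> into blocks; the unions
  of the blocks with index \<open>0\<close> modulo \<open>4\<close>, over all \<open>\<alpha>\<close>, generate a filter, and likewise for \<open>2\<close>
  modulo \<open>4\<close>. Points of blocks of the two kinds are separated by \<open>g \<alpha>\<close>, so no pair of finite-to-one
  maps sends ultrafilters extending these two filters to the same ultrafilter.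

  Hence under NCF some \<open>G\<close> is dominated by no \<open>g \<alpha>\<close>. The sets \<open>{x. g \<alpha> x < G x}\<close> then decrease modulo
  finite and generate a non-meager filter: even their images under a finite-to-one map have no
  infinite pseudo-intersection, which would yield a bound for the whole family. Given an
  ultrafilter \<open>U\<close>, NCF provides a \<open>V\<close> below both \<open>U\<close> and an ultrafilter containing these sets; push
  the sets forward to \<open>V\<close> and pull them back to \<open>U\<close>.
\<close>

unbundle cardinal_syntax

abbreviation eventually_le :: "(nat \<Rightarrow> nat) \<Rightarrow> (nat \<Rightarrow> nat) \<Rightarrow> bool"  (infix "\<le>\<^sup>*" 50) where
  "f \<le>\<^sup>* g \<equiv> (\<forall>\<^sub>F n in sequentially. f n \<le> g n)"

lemma eventually_le_trans: "f \<le>\<^sup>* g \<Longrightarrow> g \<le>\<^sup>* h \<Longrightarrow> f \<le>\<^sup>* h"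
  by (erule (1) eventually_elim2) (rule order_trans)

subsection \<open>Ultrafilters\<close>

lemma eventually_omega_filter:
  assumes "omega_filter F" "finite (- A)"
  shows "\<forall>\<^sub>F n in F. n \<in> A"
proof -
  have "\<forall>\<^sub>F n in cofinite. n \<in> A"
    using assms(2) by (simp add: eventually_cofinite Compl_eq)
  then show ?thesis
    using assms(1) unfolding omega_filter_def by (meson filter_leD)
qed

lemma omega_filter_infinite:
  assumes "omega_filter F" "\<forall>\<^sub>F n in F. n \<in> A"
  shows "infinite A"
proof
  assume "finite A"
  then have "\<forall>\<^sub>F n in F. n \<in> - A"
    using assms(1) by (intro eventually_omega_filter) auto
  with assms(2) have "\<forall>\<^sub>F n in F. False"
    by eventually_elim auto
  then show False
    using assms(1) by (auto simp: omega_filter_def eventually_False)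
qed

text \<open>Zorn's lemma for the proper filters below \<open>F\<close>, with the order reversed. A
  nonempty chain is directed, so each set in its infimum already lies in one member; hence the
  infimum is proper.\<close>

lemma exists_minimal_filter_below:
  fixes F :: "'a filter"
  assumes "F \<noteq> bot"
  shows "\<exists>U. U \<noteq> bot \<and> U \<le> F \<and> (\<forall>G. G \<noteq> bot \<longrightarrow> G \<le> U \<longrightarrow> G = U)"
proof -
  define A where "A = {G. G \<noteq> bot \<and> G \<le> F}"
  have "partial_order_on A (relation_of (\<ge>) A)"
    unfolding partial_order_on_def preorder_on_def relation_of_def
    by (auto simp: refl_on_def intro!: transI antisymI)
  moreover have "\<exists>u\<in>A. \<forall>a\<in>C. a \<ge> u" if C: "C \<in> Chains (relation_of (\<ge>) A)" for C
  proof (cases "C = {}")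
    case True
    then show ?thesis using assms by (auto simp: A_def)
  next
    case False
    have CA: "C \<subseteq> A" and tot: "\<And>G H. G \<in> C \<Longrightarrow> H \<in> C \<Longrightarrow> G \<le> H \<or> H \<le> G"
      using C unfolding Chains_def relation_of_def by auto
    have "eventually P (Inf C) \<longleftrightarrow> (\<exists>b\<in>C. eventually P b)" for P
      using False tot by (intro eventually_Inf_base) (metis inf.orderE inf.commute order_refl)+
    then have "Inf C \<noteq> bot"
      using CA by (auto simp: A_def trivial_limit_def)
    moreover have "Inf C \<le> F"
      using False CA by (auto simp: A_def intro: Inf_lower2)
    ultimately show ?thesis
      by (intro bexI[of _ "Inf C"]) (auto simp: A_def intro: Inf_lower)
  qed
  ultimately obtain U where "U \<in> A" "\<forall>a\<in>A. U \<ge> a \<longrightarrow> a = U"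
    using predicate_Zorn[of A "(\<ge>)"] by auto
  then show ?thesis
    by (intro exI[of _ U]) (auto simp: A_def)
qed

text \<open>Infinite finite intersections also meet every cofinite set, so the family and the
  cofinite sets generate a proper filter. A minimal proper filter below it decides every
  \<open>X\<close>: if adding \<open>- X\<close> keeps it proper, minimality puts \<open>- X\<close>
  into it already.\<close>

lemma exists_omega_ultrafilter:
  assumes fip: "\<And>\<B>. finite \<B> \<Longrightarrow> \<B> \<subseteq> \<A> \<Longrightarrow> infinite (\<Inter>\<B>)"
  shows "\<exists>U. omega_ultrafilter U \<and> (\<forall>A\<in>\<A>. \<forall>\<^sub>F n in U. n \<in> A)"
proof -
  define F :: "nat filter" where "F = inf cofinite (INF A\<in>\<A>. principal A)"
  have "F \<noteq> bot"
  proof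
    assume "F = bot"
    then have "eventually (\<lambda>_. False) F"
      by simp
    then obtain Q R where Q: "eventually Q cofinite" and R: "eventually R (INF A\<in>\<A>. principal A)"
      and QR: "\<forall>x. Q x \<and> R x \<longrightarrow> False"
      unfolding F_def eventually_inf by blast
    from iffD1[OF eventually_INF R] obtain \<B> where \<B>: "\<B> \<subseteq> \<A>" "finite \<B>" "eventually R (INF A\<in>\<B>. principal A)"
      by blast
    then have "\<forall>x\<in>\<Inter>\<B>. R x"
      by (simp add: INF_principal_finite eventually_principal)
    with QR have "\<Inter>\<B> \<subseteq> {x. \<not> Q x}"
      by blast
    with Q fip[OF \<B>(2,1)] show False
      unfolding eventually_cofinite using finite_subset by blast
  qed
  then obtain U where U: "U \<noteq> bot" "U \<le> F" and min: "\<And>G. G \<noteq> bot \<Longrightarrow> G \<le> U \<Longrightarrow> G = U"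
    using exists_minimal_filter_below by blast
  have "(\<forall>\<^sub>F n in U. n \<in> X) \<or> (\<forall>\<^sub>F n in U. n \<in> - X)" for X
  proof (cases "inf U (principal (- X)) = bot")
    case True
    then have "eventually (\<lambda>_. False) (inf U (principal (- X)))"
      by simp
    then show ?thesis
      by (simp add: eventually_inf_principal)
  next
    case False
    then have "inf U (principal (- X)) = U"
      by (intro min) auto
    then have "U \<le> principal (- X)"
      by (metis inf.cobounded2)
    then show ?thesis
      by (simp add: le_principal)
  qed
  moreover have "omega_filter U"
    using U unfolding omega_filter_def F_def by auto
  moreover have "\<forall>\<^sub>F n in U. n \<in> A" if "A \<in> \<A>" for A
  proof -
    have "U \<le> principal A"
      using U(2) that unfolding F_def by (meson INF_lower inf.boundedE order_trans)
    then show ?thesis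
      by (simp add: le_principal)
  qed
  ultimately show ?thesis
    unfolding omega_ultrafilter_def by blast
qed

lemma finite_to_one_vimage:
  assumes "finite_to_one f" "finite A"
  shows "finite (f -` A)"
proof -
  have "f -` A = (\<Union>y\<in>A. f -` {y})"
    by auto
  then show ?thesis
    using assms by (simp add: finite_to_one_def)
qed

text \<open>If the image were not in \<open>V\<close>, its complement would be, and the preimage of
  that complement misses \<open>A\<close>.\<close>

lemma eventually_image_KB:
  fixes f :: "nat \<Rightarrow> nat"
  assumes V: "omega_ultrafilter V" and U: "omega_ultrafilter U"
    and f: "\<And>X. \<forall>\<^sub>F n in V. n \<in> X \<Longrightarrow> \<forall>\<^sub>F n in U. n \<in> f -` X"
    and A: "\<forall>\<^sub>F n in U. n \<in> A"
  shows "\<forall>\<^sub>F n in V. n \<in> f ` A"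
proof (rule ccontr)
  assume "\<not> ?thesis"
  then have "\<forall>\<^sub>F n in V. n \<in> - f ` A"
    using V unfolding omega_ultrafilter_def by blast
  from f[OF this] A have "\<forall>\<^sub>F n in U. False"
    by eventually_elim auto
  then show False
    using U by (auto simp: omega_ultrafilter_def omega_filter_def eventually_False)
qed

subsection \<open>A fast increasing unbounded family\<close>

text \<open>
  Five iterations are what it takes to pass from any point beyond a full block of prescribed index
  modulo \<open>4\<close>.
\<close>

locale fast_family =
  fixes \<kappa> :: "'k rel" and g :: "'k \<Rightarrow> nat \<Rightarrow> nat"
  assumes card_order: "Card_order \<kappa>"
    and mono: "\<alpha> \<in> Field \<kappa> \<Longrightarrow> mono (g \<alpha>)"
    and increasing: "\<alpha> \<in> Field \<kappa> \<Longrightarrow> n < g \<alpha> n"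
    and fast: "\<alpha> \<in> Field \<kappa> \<Longrightarrow> \<beta> \<in> underS \<kappa> \<alpha> \<Longrightarrow> (g \<beta> ^^ 5) \<le>\<^sup>* g \<alpha>"
    and unbounded: "\<exists>\<alpha>\<in>Field \<kappa>. \<not> g \<alpha> \<le>\<^sup>* h"

text \<open>Functions are coded by their graphs because towers are indexed by the type \<^typ>\<open>nat set\<close>.\<close>

definition graph_code :: "(nat \<Rightarrow> nat) \<Rightarrow> nat set" where
  "graph_code f = range (\<lambda>n. prod_encode (n, f n))"

lemma inj_graph_code: "inj graph_code"
proof (rule injI)
  fix f f' assume eq: "graph_code f = graph_code f'"
  show "f = f'"
  proof
    fix n
    have "prod_encode (n, f n) \<in> graph_code f"
      by (simp add: graph_code_def)
    with eq have "prod_encode (n, f n) \<in> graph_code f'"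
      by simp
    then show "f n = f' n"
      by (auto simp: graph_code_def)
  qed
qed

text \<open>Take an unbounded family of least cardinality. A proper initial segment of its index
  order is smaller, so functions attached to it have a common bound. This allows a well-founded
  recursion, and keeping each \<open>g \<alpha>\<close> above \<open>D \<alpha>\<close> preserves
  unboundedness.\<close>

lemma exists_fast_family: "\<exists>(\<kappa> :: nat set rel) g. fast_family \<kappa> g"
proof -
  define D where "D = inv graph_code"
  have D: "D (graph_code f) = f" for f
    by (simp add: D_def inj_graph_code)
  define unb where "unb R \<longleftrightarrow> (\<forall>h. \<exists>\<alpha>\<in>R. \<not> D \<alpha> \<le>\<^sup>* h)" for R
  have "unb UNIV"
    unfolding unb_def
  proof
    fix h :: "nat \<Rightarrow> nat"
    have "\<not> D (graph_code (Suc \<circ> h)) \<le>\<^sup>* h"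
      by (simp add: D)
    then show "\<exists>\<alpha>\<in>UNIV. \<not> D \<alpha> \<le>\<^sup>* h"
      by blast
  qed
  then have "\<exists>r\<in>{|R| | R. unb R}. \<forall>r'\<in>{|R| | R. unb R}. r \<le>o r'"
    by (intro exists_minim_Card_order) (auto simp: card_of_Card_order)
  then obtain R where R: "unb R" and min: "\<And>S. unb S \<Longrightarrow> |R| \<le>o |S|"
    by blast
  define \<kappa> where "\<kappa> = |R|"
  have \<kappa>: "Card_order \<kappa>" "Field \<kappa> = R"
    using card_of_Card_order[of R] by (simp_all add: \<kappa>_def Field_card_of)
  have wf: "wf (\<kappa> - Id)"
    using \<kappa>(1) by (simp add: card_order_on_def well_order_on_def)
  have under: "(\<beta>, \<alpha>) \<in> \<kappa> - Id \<longleftrightarrow> \<beta> \<in> underS \<kappa> \<alpha>" for \<alpha> \<beta>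
    by (auto simp: underS_def)
  have bounded: "\<exists>h. \<forall>\<beta>\<in>underS \<kappa> \<alpha>. F \<beta> \<le>\<^sup>* h" if "\<alpha> \<in> R" for F \<alpha>
  proof -
    define S where "S = (graph_code \<circ> F) ` underS \<kappa> \<alpha>"
    have "|S| \<le>o |underS \<kappa> \<alpha>|"
      unfolding S_def by (rule card_of_image)
    also have "|underS \<kappa> \<alpha>| <o |R|"
      using card_of_underS[OF \<kappa>(1)] that \<kappa>(2) \<kappa>_def by metis
    finally have "\<not> unb S"
      using min not_ordLess_ordLeq by blast
    then show ?thesis
      unfolding unb_def S_def by (auto simp: D)
  qed
  \<comment> \<open>Recursion runs over the whole index type, so the requirement is made vacuous
    outside \<open>R\<close>.\<close>
  define P where "P f \<alpha> r \<longleftrightarrow> (\<alpha> \<in> R \<longrightarrow> mono r \<and> (\<forall>n. n < r n) \<and> D \<alpha> \<le>\<^sup>* r \<and>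
      (\<forall>\<beta>\<in>underS \<kappa> \<alpha>. (f \<beta> ^^ 5) \<le>\<^sup>* r))" for f :: "nat set \<Rightarrow> nat \<Rightarrow> nat" and \<alpha> r
  have "\<exists>g. \<forall>\<alpha>. P g \<alpha> (g \<alpha>)"
  proof (rule dependent_wf_choice[OF wf])
    show "P f \<alpha> r = P f' \<alpha> r" if "\<And>\<beta>. (\<beta>, \<alpha>) \<in> \<kappa> - Id \<Longrightarrow> f \<beta> = f' \<beta>" for f f' \<alpha> r
      using that unfolding P_def under by auto
  next
    fix \<alpha> f
    show "\<exists>r. P f \<alpha> r"
    proof (cases "\<alpha> \<in> R")
      case True
      then obtain h where h: "\<And>\<beta>. \<beta> \<in> underS \<kappa> \<alpha> \<Longrightarrow> (f \<beta> ^^ 5) \<le>\<^sup>* h"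
        using bounded[of \<alpha> "\<lambda>\<beta>. f \<beta> ^^ 5"] by blast
      \<comment> \<open>Summing over all \<open>i \<le> n\<close> makes \<open>r\<close> monotone,
        and \<open>Suc n\<close> puts it strictly above the identity.\<close>
      define r where "r n = Suc n + (\<Sum>i\<le>n. h i + D \<alpha> i)" for n
      have "h n + D \<alpha> n \<le> (\<Sum>i\<le>n. h i + D \<alpha> i)" for n
        by (rule member_le_sum) auto
      then have le: "h n \<le> r n" "D \<alpha> n \<le> r n" for n
        unfolding r_def by (meson add_leD1 add_leD2 trans_le_add2)+
      have "(f \<beta> ^^ 5) \<le>\<^sup>* r" if "\<beta> \<in> underS \<kappa> \<alpha>" for \<beta>
        using h[OF that] by eventually_elim (meson le order_trans)
      moreover have "mono r"
        unfolding r_def by (intro monoI add_mono sum_mono2) auto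
      moreover have "n < r n" for n
        unfolding r_def by simp
      ultimately show ?thesis
        unfolding P_def using le by (intro exI[of _ r]) auto
    qed (simp add: P_def)
  qed
  then obtain g where g: "\<And>\<alpha>. P g \<alpha> (g \<alpha>)"
    by blast
  have "fast_family \<kappa> g"
  proof
    show "\<exists>\<alpha>\<in>Field \<kappa>. \<not> g \<alpha> \<le>\<^sup>* h" for h
    proof -
      obtain \<alpha> where "\<alpha> \<in> R" "\<not> D \<alpha> \<le>\<^sup>* h"
        using R unfolding unb_def by blast
      then have "\<not> g \<alpha> \<le>\<^sup>* h"
        using g[of \<alpha>] eventually_le_trans unfolding P_def by blast
      then show ?thesis
        using \<open>\<alpha> \<in> R\<close> \<kappa>(2) by blast
    qed
  qed (use g \<kappa> in \<open>auto simp: P_def\<close>)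
  then show ?thesis
    by blast
qed

section \<open>Index order and iterates of the family\<close>

context fast_family
begin

lemma trichotomy:
  assumes "\<alpha> \<in> Field \<kappa>" "\<beta> \<in> Field \<kappa>"
  shows "\<beta> \<in> underS \<kappa> \<alpha> \<or> (\<alpha>, \<beta>) \<in> \<kappa>"
proof -
  have "refl_on (Field \<kappa>) \<kappa>" "total_on (Field \<kappa>) \<kappa>"
    using card_order unfolding card_order_on_def well_order_on_def linear_order_on_def
      partial_order_on_def preorder_on_def by blast+
  with assms show ?thesis
    by (cases "\<alpha> = \<beta>") (auto simp: underS_def refl_on_def total_on_def)
qed

lemma finite_has_max:
  assumes "finite S" "S \<noteq> {}" "S \<subseteq> Field \<kappa>"
  shows "\<exists>\<mu>\<in>S. \<forall>\<beta>\<in>S. (\<beta>, \<mu>) \<in> \<kappa>"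
  using assms
proof (induction S rule: finite_ne_induct)
  case (singleton \<alpha>)
  then show ?case
    using trichotomy[of \<alpha> \<alpha>] by (auto simp: underS_def)
next
  case (insert \<alpha> S)
  then obtain \<mu> where \<mu>: "\<mu> \<in> S" "\<forall>\<beta>\<in>S. (\<beta>, \<mu>) \<in> \<kappa>"
    by auto
  have tr: "trans \<kappa>"
    using card_order unfolding card_order_on_def well_order_on_def linear_order_on_def
      partial_order_on_def preorder_on_def by blast
  have refl: "(\<alpha>, \<alpha>) \<in> \<kappa>"
    using trichotomy[of \<alpha> \<alpha>] insert.prems by (auto simp: underS_def)
  consider "(\<alpha>, \<mu>) \<in> \<kappa>" | "(\<mu>, \<alpha>) \<in> \<kappa>"
    using trichotomy[of \<alpha> \<mu>] insert.prems \<mu>(1) by (auto simp: underS_def)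
  then show ?case
  proof cases
    case 1
    then show ?thesis using \<mu> by auto
  next
    case 2
    then have "\<forall>\<beta>\<in>S. (\<beta>, \<alpha>) \<in> \<kappa>"
      using \<mu> tr by (meson transD)
    then show ?thesis using refl by auto
  qed
qed

lemma iterate_ge: "\<alpha> \<in> Field \<kappa> \<Longrightarrow> x + k \<le> (g \<alpha> ^^ k) x"
proof (induction k)
  case (Suc k)
  have "x + k \<le> (g \<alpha> ^^ k) x"
    by (rule Suc.IH[OF Suc.prems])
  also have "\<dots> < (g \<alpha> ^^ Suc k) x"
    using increasing[OF Suc.prems] by simp
  finally show ?case
    by simp
qed simp

lemma iterate_mono_exp:
  assumes "\<alpha> \<in> Field \<kappa>" "i \<le> j"
  shows "(g \<alpha> ^^ i) x \<le> (g \<alpha> ^^ j) x"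
proof -
  have "j = (j - i) + i"
    using assms(2) by simp
  then obtain k where "j = k + i" ..
  then show ?thesis
    using iterate_ge[OF assms(1), of "(g \<alpha> ^^ i) x" k] by (simp add: funpow_add)
qed

lemma iterate_mono: "\<alpha> \<in> Field \<kappa> \<Longrightarrow> x \<le> y \<Longrightarrow> (g \<alpha> ^^ k) x \<le> (g \<alpha> ^^ k) y"
  by (rule funpow_mono[OF mono])

lemma family_mono:
  assumes "(\<alpha>, \<beta>) \<in> \<kappa>"
  shows "g \<alpha> \<le>\<^sup>* g \<beta>"
proof (cases "\<alpha> = \<beta>")
  case False
  then have F: "\<alpha> \<in> Field \<kappa>" "\<beta> \<in> Field \<kappa>" "\<alpha> \<in> underS \<kappa> \<beta>"
    using assms by (auto simp: underS_def Field_def)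
  have le: "g \<alpha> n \<le> (g \<alpha> ^^ 5) n" for n
    using iterate_mono_exp[OF F(1), of 1 5 n] by simp
  show ?thesis
    using fast[OF F(2,3)] by eventually_elim (rule order_trans[OF le])
qed simp

subsection \<open>The undominated case: a tower surviving finite-to-one maps\<close>

text \<open>The first two claims hold because the family increases modulo finite and
  \<open>G\<close> escapes each member. For the third, a pseudo-intersection \<open>Y\<close> of the
  images would yield one function bounding every \<open>g \<alpha>\<close>, against
  \<open>unbounded\<close>.\<close>

lemma undominated_tower:
  fixes f :: "nat \<Rightarrow> nat"
  assumes G: "\<forall>\<alpha>\<in>Field \<kappa>. \<not> G \<le>\<^sup>* g \<alpha>"
  defines "S \<equiv> \<lambda>\<alpha>. {x. g \<alpha> x < G x}"
  shows "(\<alpha>, \<beta>) \<in> \<kappa> \<Longrightarrow> S \<beta> \<subseteq>\<^sup>* S \<alpha>"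
    and "finite B \<Longrightarrow> B \<subseteq> Field \<kappa> \<Longrightarrow> infinite (\<Inter>\<alpha>\<in>B. S \<alpha>)"
    and "\<lbrakk>finite_to_one f; infinite Y\<rbrakk> \<Longrightarrow> \<exists>\<alpha>\<in>Field \<kappa>. \<not> Y \<subseteq>\<^sup>* f ` S \<alpha>"
proof -
  show decr: "S \<beta> \<subseteq>\<^sup>* S \<alpha>" if "(\<alpha>, \<beta>) \<in> \<kappa>" for \<alpha> \<beta>
  proof -
    have "finite {n. \<not> g \<alpha> n \<le> g \<beta> n}"
      using family_mono[OF that] by (simp add: cofinite_eq_sequentially[symmetric] eventually_cofinite)
    then show ?thesis
      unfolding almost_subset_def S_def by (rule rev_finite_subset) auto
  qed
  show "infinite (\<Inter>\<alpha>\<in>B. S \<alpha>)" if B: "finite B" "B \<subseteq> Field \<kappa>" for B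
  proof (cases "B = {}")
    case False
    then obtain \<mu> where \<mu>: "\<mu> \<in> B" "\<forall>\<beta>\<in>B. (\<beta>, \<mu>) \<in> \<kappa>"
      using finite_has_max B by blast
    have "infinite {n. \<not> G n \<le> g \<mu> n}"
      using G \<mu> B by (auto simp: cofinite_eq_sequentially[symmetric] eventually_cofinite)
    then have inf: "infinite (S \<mu>)"
      by (simp add: S_def not_le)
    have "finite (\<Union>\<beta>\<in>B. S \<mu> - S \<beta>)"
      using B(1) by (rule finite_UN_I) (use decr \<mu>(2) in \<open>simp add: almost_subset_def\<close>)
    with inf have "infinite (S \<mu> - (\<Union>\<beta>\<in>B. S \<mu> - S \<beta>))"
      by (simp add: Diff_infinite_finite)
    then show ?thesis
      by (rule infinite_super[rotated]) auto
  qed simp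
  show "\<exists>\<alpha>\<in>Field \<kappa>. \<not> Y \<subseteq>\<^sup>* f ` S \<alpha>" if f: "finite_to_one f" and Y: "infinite Y" for f :: "nat \<Rightarrow> nat" and Y
  proof (rule ccontr)
    assume "\<not> ?thesis"
    then have pseudo: "\<And>\<alpha>. \<alpha> \<in> Field \<kappa> \<Longrightarrow> Y \<subseteq>\<^sup>* f ` S \<alpha>"
      by blast
    \<comment> \<open>Every preimage of such a \<open>y\<close> exceeds \<open>k\<close>, so values
      of \<open>g \<alpha>\<close> there bound \<open>g \<alpha> k\<close>; the condition
      \<open>k \<le> y\<close> lets \<open>y\<close> leave any finite exceptional set.\<close>
    have "\<exists>y\<in>Y. k \<le> y \<and> y \<notin> f ` {..k}" for k
    proof -
      have "infinite (Y - ({..<k} \<union> f ` {..k}))"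
        using Y by (intro Diff_infinite_finite) auto
      then obtain y where "y \<in> Y - ({..<k} \<union> f ` {..k})"
        using infinite_imp_nonempty by blast
      then show ?thesis by (auto simp: not_less)
    qed
    then obtain y where y: "\<And>k. y k \<in> Y" "\<And>k. k \<le> y k" "\<And>k. y k \<notin> f ` {..k}"
      by metis
    \<comment> \<open>Which preimage of \<open>y k\<close> lies in \<open>S \<alpha>\<close> depends
      on \<alpha>; summing \<open>G\<close> over the finite fibre bounds all cases at once.\<close>
    define h where "h k = (\<Sum>x\<in>f -` {y k}. G x)" for k
    have "g \<alpha> \<le>\<^sup>* h" if \<alpha>: "\<alpha> \<in> Field \<kappa>" for \<alpha>
    proof -
      have "finite (Y - f ` S \<alpha>)"
        using pseudo[OF \<alpha>] by (simp add: almost_subset_def)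
      then obtain N where N: "\<forall>z\<in>Y - f ` S \<alpha>. z < N"
        by (meson finite_nat_set_iff_bounded)
      have "g \<alpha> k \<le> h k" if "k \<ge> N" for k
      proof -
        have "y k \<in> f ` S \<alpha>"
          using N y(1,2)[of k] that by (meson DiffI leD le_trans)
        then obtain x where x: "x \<in> S \<alpha>" "f x = y k"
          by auto
        then have "k \<le> x"
          using y(3)[of k] by (metis atMost_iff image_eqI linear)
        then have "g \<alpha> k \<le> g \<alpha> x"
          using mono[OF \<alpha>] by (simp add: monoD)
        also have "\<dots> \<le> G x"
          using x(1) by (simp add: S_def)
        also have "\<dots> \<le> h k"
          unfolding h_def using f x(2) by (intro member_le_sum) (auto simp: finite_to_one_def)
        finally show ?thesis .
      qed
      then show ?thesis
        by (auto simp: eventually_sequentially)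
    qed
    then show False
      using unbounded[of h] by blast
  qed
qed

text \<open>Images and finite-to-one preimages preserve almost inclusion. A pseudo-intersection of
  the pulled-back sets would have an infinite image under the finite-to-one \<open>f\<close>, which
  would be a pseudo-intersection of the forward images.\<close>

lemma undominated_NCF_tower:
  assumes G: "\<forall>\<alpha>\<in>Field \<kappa>. \<not> G \<le>\<^sup>* g \<alpha>"
    and NCF: NCF and U: "omega_ultrafilter U"
  shows "\<exists>T. tower_in U \<kappa> T"
proof -
  define S where "S \<alpha> = {x. g \<alpha> x < G x}" for \<alpha>
  note S = undominated_tower[OF G, folded S_def]
  have "infinite (\<Inter>\<B>)" if \<B>: "finite \<B>" "\<B> \<subseteq> S ` Field \<kappa>" for \<B>
  proof -
    obtain B where "finite B" "B \<subseteq> Field \<kappa>" "\<B> = S ` B"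
      using finite_subset_image[OF \<B>] by blast
    then show ?thesis
      using S(2) by simp
  qed
  from exists_omega_ultrafilter[of "S ` Field \<kappa>", OF this] obtain W where W: "omega_ultrafilter W"
      "\<And>\<alpha>. \<alpha> \<in> Field \<kappa> \<Longrightarrow> \<forall>\<^sub>F n in W. n \<in> S \<alpha>"
    by auto
  from NCF U W(1) obtain V f f\<^sub>0 where V: "omega_ultrafilter V"
    and f: "finite_to_one f" "\<And>X. \<forall>\<^sub>F n in V. n \<in> X \<Longrightarrow> \<forall>\<^sub>F n in U. n \<in> f -` X"
    and f\<^sub>0: "finite_to_one f\<^sub>0" "\<And>X. \<forall>\<^sub>F n in V. n \<in> X \<Longrightarrow> \<forall>\<^sub>F n in W. n \<in> f\<^sub>0 -` X"
    unfolding NCF_def KB_le_def by metis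
  have "tower_in U \<kappa> (\<lambda>\<alpha>. f -` f\<^sub>0 ` S \<alpha>)"
    unfolding tower_in_def
  proof (intro conjI ballI allI impI)
    show "Card_order \<kappa>"
      by (rule card_order)
    show "\<forall>\<^sub>F n in U. n \<in> f -` f\<^sub>0 ` S \<alpha>" if "\<alpha> \<in> Field \<kappa>" for \<alpha>
      using eventually_image_KB[OF V W(1) f\<^sub>0(2) W(2)[OF that]] f(2) by blast
    show "f -` f\<^sub>0 ` S \<beta> \<subseteq>\<^sup>* f -` f\<^sub>0 ` S \<alpha>" if "(\<alpha>, \<beta>) \<in> \<kappa>" for \<alpha> \<beta>
    proof -
      have "finite (f -` f\<^sub>0 ` (S \<beta> - S \<alpha>))"
        using S(1)[OF that] by (intro finite_to_one_vimage[OF f(1)]) (simp add: almost_subset_def)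
      then show ?thesis
        unfolding almost_subset_def by (rule rev_finite_subset) auto
    qed
    show "\<nexists>X. infinite X \<and> (\<forall>\<alpha>\<in>Field \<kappa>. X \<subseteq>\<^sup>* f -` f\<^sub>0 ` S \<alpha>)"
    proof
      assume "\<exists>X. infinite X \<and> (\<forall>\<alpha>\<in>Field \<kappa>. X \<subseteq>\<^sup>* f -` f\<^sub>0 ` S \<alpha>)"
      then obtain X where X: "infinite X" "\<And>\<alpha>. \<alpha> \<in> Field \<kappa> \<Longrightarrow> X \<subseteq>\<^sup>* f -` f\<^sub>0 ` S \<alpha>"
        by blast
      have "infinite (f ` X)"
      proof
        assume "finite (f ` X)"
        then have "finite (f -` f ` X)"
          by (rule finite_to_one_vimage[OF f(1)])
        moreover have "X \<subseteq> f -` f ` X"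
          by auto
        ultimately show False
          using X(1) finite_subset by blast
      qed
      moreover have "f ` X \<subseteq>\<^sup>* f\<^sub>0 ` S \<alpha>" if "\<alpha> \<in> Field \<kappa>" for \<alpha>
      proof -
        have "finite (f ` (X - f -` f\<^sub>0 ` S \<alpha>))"
          using X(2)[OF that] by (simp add: almost_subset_def)
        then show ?thesis
          unfolding almost_subset_def by (rule rev_finite_subset) auto
      qed
      ultimately show False
        using S(3)[OF f\<^sub>0(1), of "f ` X"] by blast
    qed
  qed
  then show ?thesis
    by blast
qed

subsection \<open>The dominating case: failure of near coherence\<close>

text \<open>For \<alpha> in the field, the iterates of \<open>0\<close> strictly increase, so the
  blocks partition \<omega> into intervals.\<close>

definition block :: "'k \<Rightarrow> nat \<Rightarrow> nat set" where
  "block \<alpha> n = {(g \<alpha> ^^ n) 0..<(g \<alpha> ^^ Suc n) 0}"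

definition block_union :: "nat \<Rightarrow> 'k \<Rightarrow> nat set" where
  "block_union r \<alpha> = (\<Union>n. block \<alpha> (4 * n + r))"

text \<open>The block after that of \<open>x\<close> lies entirely before \<open>y\<close>: the
  right end of the block of \<open>x\<close> bounds \<open>x\<close>, and \<open>g \<alpha>\<close>
  maps it to the right end of the next block.\<close>

lemma block_gap:
  assumes "\<alpha> \<in> Field \<kappa>" "x \<in> block \<alpha> i" "y \<in> block \<alpha> j" "i + 2 \<le> j"
  shows "g \<alpha> x \<le> y"
proof -
  have "g \<alpha> x \<le> g \<alpha> ((g \<alpha> ^^ Suc i) 0)"
    using assms mono by (intro monoD[of "g \<alpha>"]) (auto simp: block_def)
  also have "\<dots> = (g \<alpha> ^^ (i + 2)) 0"
    by (simp add: numeral_2_eq_2)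
  also have "\<dots> \<le> (g \<alpha> ^^ j) 0"
    using assms by (intro iterate_mono_exp) auto
  also have "\<dots> \<le> y"
    using assms by (simp add: block_def)
  finally show ?thesis .
qed

text \<open>The first iterate of \<open>0\<close> reaching \<open>x\<close> is at most
  \<open>g \<alpha> x\<close>. At most three further steps reach the index class of
  \<open>r\<close>, and one more ends the block: five applications in all.\<close>

lemma exists_block:
  assumes \<alpha>: "\<alpha> \<in> Field \<kappa>" and r: "r < 4"
  shows "\<exists>z. x \<le> z \<and> {z..<g \<alpha> z} \<subseteq> block_union r \<alpha> \<and> g \<alpha> z \<le> (g \<alpha> ^^ 5) x"
proof -
  let ?h = "\<lambda>n. (g \<alpha> ^^ n) 0"
  define i where "i = (LEAST i. x \<le> ?h i)"
  have ex: "x \<le> ?h x"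
    using iterate_ge[OF \<alpha>, of 0 x] by simp
  then have i: "x \<le> ?h i"
    unfolding i_def by (rule LeastI)
  have hi: "?h i \<le> g \<alpha> x"
  proof (cases i)
    case (Suc j)
    then have "?h j < x"
      using not_less_Least[of j "\<lambda>i. x \<le> ?h i"] unfolding i_def by (simp add: not_le)
    then show ?thesis
      using mono[OF \<alpha>] Suc by (simp add: monoD)
  qed simp
  \<comment> \<open>The least \<open>n\<close> with \<open>i \<le> 4 * n + r\<close>. Since
    \<open>r \<le> 3\<close>, the subtraction does not truncate.\<close>
  define n where "n = (i + 3 - r) div 4"
  have n: "i \<le> 4 * n + r" "4 * n + r + 1 \<le> i + 4"
    using r unfolding n_def by presburger+
  define z where "z = ?h (4 * n + r)"
  have "x \<le> z"
    using i iterate_mono_exp[OF \<alpha> n(1), of 0] unfolding z_def by linarith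
  moreover have "{z..<g \<alpha> z} \<subseteq> block_union r \<alpha>"
    unfolding block_union_def z_def by (rule SUP_upper2[of n]) (auto simp: block_def)
  moreover have "g \<alpha> z \<le> (g \<alpha> ^^ 5) x"
  proof -
    have "g \<alpha> z = ?h (4 * n + r + 1)"
      by (simp add: z_def)
    also have "\<dots> \<le> ?h (4 + i)"
      using n(2) by (intro iterate_mono_exp \<alpha>) auto
    also have "\<dots> = (g \<alpha> ^^ 4) (?h i)"
      by (simp only: funpow_add o_apply)
    also have "\<dots> \<le> (g \<alpha> ^^ 4) (g \<alpha> x)"
      by (rule iterate_mono[OF \<alpha> hi])
    also have "\<dots> = (g \<alpha> ^^ 5) x"
      using funpow_Suc_right[of 4 "g \<alpha>"] by (simp del: funpow.simps)
    finally show ?thesis .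
  qed
  ultimately show ?thesis
    by blast
qed

text \<open>
  The top element \<open>\<mu>\<close> of \<open>B\<close> contributes a full block \<open>{z..<g \<mu> z}\<close>, inside which the remaining
  elements already have a common point, because \<open>g \<mu>\<close> outgrows five iterations of each of them.
\<close>

lemma block_unions_meet:
  assumes r: "r < 4"
  shows "\<lbrakk>finite B; B \<subseteq> Field \<kappa>; \<And>\<alpha>. \<alpha> \<in> B \<Longrightarrow> (g \<alpha> ^^ 5) \<le>\<^sup>* G; \<And>x. x < G x\<rbrakk> \<Longrightarrow>
    \<forall>\<^sub>F x in sequentially. \<exists>y. x \<le> y \<and> y < G x \<and> y \<in> (\<Inter>\<alpha>\<in>B. block_union r \<alpha>)"
proof (induction "card B" arbitrary: B G rule: less_induct)
  case less
  show ?case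
  proof (cases "B = {}")
    case True
    then show ?thesis
      using less.prems(4) by (auto intro!: always_eventually)
  next
    case False
    then obtain \<mu> where \<mu>: "\<mu> \<in> B" "\<forall>\<beta>\<in>B. (\<beta>, \<mu>) \<in> \<kappa>"
      using finite_has_max[OF less.prems(1) False less.prems(2)] by blast
    then have \<mu>F: "\<mu> \<in> Field \<kappa>"
      using less.prems(2) by blast
    \<comment> \<open>The induction hypothesis is applied with \<open>g \<mu>\<close> in the role of
      \<open>G\<close>; this is why \<open>G\<close> is generalised.\<close>
    let ?B = "B - {\<mu>}"
    have "\<forall>\<^sub>F x in sequentially. \<exists>y. x \<le> y \<and> y < g \<mu> x \<and> y \<in> (\<Inter>\<alpha>\<in>?B. block_union r \<alpha>)"
    proof (rule less.hyps)
      show "card ?B < card B"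
        using less.prems(1) \<mu>(1) by (rule card_Diff1_less)
      show "(g \<beta> ^^ 5) \<le>\<^sup>* g \<mu>" if "\<beta> \<in> ?B" for \<beta>
        using that \<mu> by (intro fast[OF \<mu>F]) (auto simp: underS_def)
    qed (use less.prems increasing[OF \<mu>F] in auto)
    then obtain N where N:
      "\<And>x. N \<le> x \<Longrightarrow> \<exists>y. x \<le> y \<and> y < g \<mu> x \<and> y \<in> (\<Inter>\<alpha>\<in>?B. block_union r \<alpha>)"
      unfolding eventually_sequentially by blast
    have "\<forall>\<^sub>F x in sequentially. (g \<mu> ^^ 5) x \<le> G x"
      using less.prems(3) \<mu>(1) by blast
    then show ?thesis
      using eventually_ge_at_top[of N]
    proof eventually_elim
      case (elim x)
      obtain z where z: "x \<le> z" "{z..<g \<mu> z} \<subseteq> block_union r \<mu>" "g \<mu> z \<le> (g \<mu> ^^ 5) x"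
        using exists_block[OF \<mu>F r] by blast
      obtain y where y: "z \<le> y" "y < g \<mu> z" "y \<in> (\<Inter>\<alpha>\<in>?B. block_union r \<alpha>)"
        using N[of z] z(1) elim(2) by auto
      have "y \<in> block_union r \<mu>"
        using y z(2) by auto
      then have "y \<in> (\<Inter>\<alpha>\<in>B. block_union r \<alpha>)"
        using y(3) by blast
      then show ?case
        using y z elim(1) by (intro exI[of _ y]) linarith
    qed
  qed
qed

lemma exists_block_ultrafilter:
  assumes r: "r < 4"
  shows "\<exists>U. omega_ultrafilter U \<and> (\<forall>\<alpha>\<in>Field \<kappa>. \<forall>\<^sub>F n in U. n \<in> block_union r \<alpha>)"
proof -
  have "infinite (\<Inter>\<B>)" if \<B>: "finite \<B>" "\<B> \<subseteq> block_union r ` Field \<kappa>" for \<B>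
  proof -
    obtain B where B: "finite B" "B \<subseteq> Field \<kappa>" "\<B> = block_union r ` B"
      using finite_subset_image[OF \<B>] by blast
    \<comment> \<open>Any function strictly above the identity and above the five-fold iterates of
      all members of \<open>B\<close> would do.\<close>
    define G where "G x = Suc x + (\<Sum>\<alpha>\<in>B. (g \<alpha> ^^ 5) x)" for x
    have "(g \<alpha> ^^ 5) x \<le> G x" if "\<alpha> \<in> B" for \<alpha> x
      unfolding G_def using B(1) that
      by (intro trans_le_add2 member_le_sum[where f = "\<lambda>\<alpha>. (g \<alpha> ^^ 5) x"]) auto
    then have "\<forall>\<^sub>F x in sequentially. \<exists>y. x \<le> y \<and> y < G x \<and> y \<in> (\<Inter>\<alpha>\<in>B. block_union r \<alpha>)"
      by (intro block_unions_meet r B) (auto simp: G_def)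
    then obtain N where
      N: "\<forall>x\<ge>N. \<exists>y. x \<le> y \<and> y < G x \<and> y \<in> (\<Inter>\<alpha>\<in>B. block_union r \<alpha>)"
      unfolding eventually_sequentially ..
    show ?thesis
      unfolding infinite_nat_iff_unbounded_le
    proof
      fix m
      obtain y where "max m N \<le> y" "y \<in> \<Inter>\<B>"
        using N[rule_format, OF max.cobounded2[of N m]] B(3) by metis
      then show "\<exists>n\<ge>m. n \<in> \<Inter>\<B>"
        by (intro exI[of _ y]) simp
    qed
  qed
  from exists_omega_ultrafilter[of "block_union r ` Field \<kappa>", OF this] show ?thesis
    by auto
qed

text \<open>Fibres of \<open>f'\<close> are finite. Used in both directions, this bounds each of two
  points with a common image by a function of the other.\<close>

lemma exists_image_bound:
  fixes f f' :: "nat \<Rightarrow> nat"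
  assumes "finite_to_one f'"
  shows "\<exists>G. \<forall>x y. f x = f' y \<longrightarrow> y \<le> G x"
proof -
  have "\<exists>m. \<forall>y. f x = f' y \<longrightarrow> y \<le> m" for x
  proof -
    have "finite (f' -` {f x})"
      using assms by (simp add: finite_to_one_def)
    then obtain m where "\<forall>y\<in>f' -` {f x}. y \<le> m"
      by (meson finite_nat_set_iff_bounded_le)
    then have "\<forall>y. f x = f' y \<longrightarrow> y \<le> m"
      by (simp add: eq_commute)
    then show ?thesis ..
  qed
  then show ?thesis by metis
qed

lemma dominating_not_NCF:
  assumes dom: "\<And>h. \<exists>\<alpha>\<in>Field \<kappa>. h \<le>\<^sup>* g \<alpha>"
  shows "\<not> NCF"
proof
  assume NCF
  obtain U\<^sub>0 where U\<^sub>0: "omega_ultrafilter U\<^sub>0"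
      "\<And>\<alpha>. \<alpha> \<in> Field \<kappa> \<Longrightarrow> \<forall>\<^sub>F n in U\<^sub>0. n \<in> block_union 0 \<alpha>"
    using exists_block_ultrafilter[of 0] by auto
  obtain U\<^sub>1 where U\<^sub>1: "omega_ultrafilter U\<^sub>1"
      "\<And>\<alpha>. \<alpha> \<in> Field \<kappa> \<Longrightarrow> \<forall>\<^sub>F n in U\<^sub>1. n \<in> block_union 2 \<alpha>"
    using exists_block_ultrafilter[of 2] by auto
  from \<open>NCF\<close> U\<^sub>0(1) U\<^sub>1(1) obtain V f\<^sub>0 f\<^sub>1 where V: "omega_ultrafilter V"
    and f\<^sub>0: "finite_to_one f\<^sub>0" "\<And>X. \<forall>\<^sub>F n in V. n \<in> X \<Longrightarrow> \<forall>\<^sub>F n in U\<^sub>0. n \<in> f\<^sub>0 -` X"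
    and f\<^sub>1: "finite_to_one f\<^sub>1" "\<And>X. \<forall>\<^sub>F n in V. n \<in> X \<Longrightarrow> \<forall>\<^sub>F n in U\<^sub>1. n \<in> f\<^sub>1 -` X"
    unfolding NCF_def KB_le_def by metis
  obtain G\<^sub>0 where G\<^sub>0: "\<And>x y. f\<^sub>0 x = f\<^sub>1 y \<Longrightarrow> y \<le> G\<^sub>0 x"
    using exists_image_bound[OF f\<^sub>1(1)] by metis
  obtain G\<^sub>1 where G\<^sub>1: "\<And>x y. f\<^sub>1 y = f\<^sub>0 x \<Longrightarrow> x \<le> G\<^sub>1 y"
    using exists_image_bound[OF f\<^sub>0(1)] by metis
  \<comment> \<open>The successor makes the later inequalities strict, which is needed against the
    weak one in \<open>block_gap\<close>.\<close>
  obtain \<alpha> where \<alpha>: "\<alpha> \<in> Field \<kappa>" "(\<lambda>n. Suc (max (G\<^sub>0 n) (G\<^sub>1 n))) \<le>\<^sup>* g \<alpha>"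
    using dom[of "\<lambda>n. Suc (max (G\<^sub>0 n) (G\<^sub>1 n))"] by blast
  then obtain N where N: "\<And>n. N \<le> n \<Longrightarrow> G\<^sub>0 n < g \<alpha> n \<and> G\<^sub>1 n < g \<alpha> n"
    by (auto simp: eventually_sequentially Suc_le_eq)
  have "\<forall>\<^sub>F n in V. n \<in> f\<^sub>0 ` block_union 0 \<alpha>"
    by (rule eventually_image_KB[OF V U\<^sub>0(1) f\<^sub>0(2) U\<^sub>0(2)[OF \<alpha>(1)]])
  moreover have "\<forall>\<^sub>F n in V. n \<in> f\<^sub>1 ` block_union 2 \<alpha>"
    by (rule eventually_image_KB[OF V U\<^sub>1(1) f\<^sub>1(2) U\<^sub>1(2)[OF \<alpha>(1)]])
  ultimately have "\<forall>\<^sub>F n in V. n \<in> f\<^sub>0 ` block_union 0 \<alpha> \<inter> f\<^sub>1 ` block_union 2 \<alpha>"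
    by eventually_elim auto
  then have "infinite (f\<^sub>0 ` block_union 0 \<alpha> \<inter> f\<^sub>1 ` block_union 2 \<alpha>)"
    using V omega_filter_infinite unfolding omega_ultrafilter_def by blast
  \<comment> \<open>Discarding the images of \<open>{..N}\<close> forces every preimage of the
    chosen value beyond \<open>N\<close>, where \<open>g \<alpha>\<close> exceeds both
    bounds.\<close>
  then have "infinite (f\<^sub>0 ` block_union 0 \<alpha> \<inter> f\<^sub>1 ` block_union 2 \<alpha> - (f\<^sub>0 ` {..N} \<union> f\<^sub>1 ` {..N}))"
    by (intro Diff_infinite_finite) auto
  then obtain v where "v \<in> f\<^sub>0 ` block_union 0 \<alpha> \<inter> f\<^sub>1 ` block_union 2 \<alpha> - (f\<^sub>0 ` {..N} \<union> f\<^sub>1 ` {..N})"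
    using infinite_imp_nonempty by blast
  then obtain x y where xy: "f\<^sub>0 x = f\<^sub>1 y" "x \<in> block_union 0 \<alpha>" "y \<in> block_union 2 \<alpha>" "N < x" "N < y"
    by (auto simp: not_le[symmetric])
  then obtain m n where mn: "x \<in> block \<alpha> (4 * m)" "y \<in> block \<alpha> (4 * n + 2)"
    by (auto simp: block_union_def)
  have less: "y < g \<alpha> x" "x < g \<alpha> y"
    using N[of x] N[of y] G\<^sub>0[of x y] G\<^sub>1[of y x] xy by auto
  show False
  \<comment> \<open>The indices \<open>4 * m\<close> and \<open>4 * n + 2\<close> always differ by
    at least two, so \<open>block_gap\<close> applies in one of the two orders.\<close>
  proof (cases "m \<le> n")
    case True
    then show False
      using block_gap[OF \<alpha>(1) mn] less by auto
  next
    case False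
    then show False
      using block_gap[OF \<alpha>(1) mn(2,1)] less by auto
  qed
qed

end

theorem theorem5p3:
  fixes U :: "nat filter"
  assumes "NCF" and "omega_ultrafilter U"
  shows "contains_tower U"
proof -
  obtain \<kappa> :: "nat set rel" and g where "fast_family \<kappa> g"
    using exists_fast_family by blast
  then interpret fast_family \<kappa> g .
  \<comment> \<open>Otherwise every function would be dominated by a member of the family, which
    refutes near coherence.\<close>
  obtain G where "\<forall>\<alpha>\<in>Field \<kappa>. \<not> G \<le>\<^sup>* g \<alpha>"
    using dominating_not_NCF assms(1) by blast
  then show ?thesis
    using undominated_NCF_tower assms unfolding contains_tower_def by blast
qed

end
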